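(* Let $G_1, \ldots, G_n$ be (finite) regular permutation groups, each $G_i \leq \mathrm{Sym}(G_i)$ acting on itself by left translation, and let $G = G_1 \times \cdots \times G_n \leq \mathrm{Sym}(G_1 \cup \cdots \cup G_n)$ be their direct product with the natural action on the disjoint union $G_1 \cup \cdots \cup G_n$. Then the Maltsev condition $\Sigma_G$ has the $n$-local-global property.
   Context: An algebra $\mathbf{A} = (A,(f_i)_{i\in I})$ is a non-empty set $A$ with a list of finitary operations $f_i\colon A^{k_i}\to A$. $\mathsf{Clo}(\mathbf A)$ is the set of term operations of $\mathbf A$, i.e. all operations obtained by composing basic operations and projections; variables of a term may be indexed by any finite set. All permutation groups act on finite sets. For a permutation group $G \leq \mathrm{Sym}(X)$ on a finite set $X$ and $t\colon A^X\to A$, write $t^\pi((x_i)_{i\in X}) = t((x_{\pi(i)})_{i\in X})$ for $\pi\in G$. $\Sigma_G$ is the set of all identities $t\approx t^\pi$, $\pi\in G$, in one $X$-ary function symbol $t$. The algebra $\mathbf A$ satisfies $\Sigma_G$ if there is $t\in\mathsf{Clo}(\mathbf A)$ with $t(\overline x)=t^\pi(\overline x)$ for all $\pi\in G$ and all $\overline x\in A^X$. For $F\subseteq A^X$, $\mathbf A$ satisfies $\Sigma_G$ on $F$ if there is $t\in\mathsf{Clo}(\mathbf A)$ with $t(\overline x)=t^\pi(\overline x)$ for all $\pi\in G$ and all $\overline x\in F$. For $k\ge 1$, $\Sigma_G$ has the $k$-local-global property if every algebra $\mathbf A$ such that $|A|^{|X|}\geq k$ and $\mathbf A$ satisfies $\Sigma_G$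 on all $k$-element sets $F\subseteq A^{X}$ satisfies $\Sigma_G$ on every finite subset of $A^{X}$. A regular permutation group $H\leq\mathrm{Sym}(H)$ is a group acting on itself by left translation, $\pi(\phi)=\pi\circ\phi$. The natural action of $G_1\times\cdots\times G_n$ on the disjoint union is: $(\pi_1,\ldots,\pi_n)(z)=\pi_i(z)$ if $z\in G_i$. *)

theory Defs
  imports "HOL-Algebra.Bij"
begin

section \<open>Algebras and term operations\<close>

text \<open>
  A \<open>k\<close>-tuple over \<open>A\<close> is an element of \<open>{..<k} \<rightarrow>\<^sub>E A\<close>, and an element of \<open>A\<^sup>X\<close> is an element
  of \<open>X \<rightarrow>\<^sub>E A\<close>. Nullary basic operations are allowed.
\<close>

record ('a, 'i) ualgebra =
  univ :: "'a set"
  idx :: "'i set"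
  arity :: "'i \<Rightarrow> nat"
  oper :: "'i \<Rightarrow> (nat \<Rightarrow> 'a) \<Rightarrow> 'a"

definition is_ualgebra :: "('a, 'i) ualgebra \<Rightarrow> bool" where
  "is_ualgebra A \<longleftrightarrow>
     univ A \<noteq> {} \<and>
     (\<forall>i\<in>idx A. oper A i \<in> ({..<arity A i} \<rightarrow>\<^sub>E univ A) \<rightarrow> univ A)"

inductive_set Clo :: "('a, 'i) ualgebra \<Rightarrow> 'x set \<Rightarrow> (('x \<Rightarrow> 'a) \<Rightarrow> 'a) set"
  for A :: "('a, 'i) ualgebra" and X :: "'x set" where
  proj: "x \<in> X \<Longrightarrow> (\<lambda>v \<in> X \<rightarrow>\<^sub>E univ A. v x) \<in> Clo A X"
| comp: "i \<in> idx A \<Longrightarrow> (\<And>j. j < arity A i \<Longrightarrow> t j \<in> Clo A X) \<Longrightarrow>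
    (\<lambda>v \<in> X \<rightarrow>\<^sub>E univ A. oper A i (\<lambda>j\<in>{..<arity A i}. t j v)) \<in> Clo A X"

lemma Clo_funcset:
  assumes "is_ualgebra A" and "t \<in> Clo A X"
  shows "t \<in> (X \<rightarrow>\<^sub>E univ A) \<rightarrow>\<^sub>E univ A"
  using assms(2)
proof induction
  case (proj x)
  then show ?case by (simp only: restrict_PiE_iff) blast
next
  case (comp i t)
  then have "oper A i (\<lambda>j\<in>{..<arity A i}. t j v) \<in> univ A" if "v \<in> X \<rightarrow>\<^sub>E univ A" for v
    using assms(1) that by (force simp: is_ualgebra_def Pi_iff PiE_iff)
  then show ?case by (simp only: restrict_PiE_iff) blast
qed


section \<open>The identities of a permutation group and the local-global property\<close>

text \<open>The operation \<open>t\<^sup>\<pi>\<close>, that is \<open>(x\<^sub>i)\<^sub>i \<mapsto> t ((x\<^bsub>\<pi>(i)\<^esub>)\<^sub>i)\<close>.\<close>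

definition perm_op :: "'x set \<Rightarrow> ('x \<Rightarrow> 'x) \<Rightarrow> (('x \<Rightarrow> 'a) \<Rightarrow> 'a) \<Rightarrow> ('x \<Rightarrow> 'a) \<Rightarrow> 'a" where
  "perm_op X p t = (\<lambda>v. t (\<lambda>i\<in>X. v (p i)))"

definition satisfies_Sigma_on ::
  "('a, 'i) ualgebra \<Rightarrow> 'x set \<Rightarrow> ('x \<Rightarrow> 'x) set \<Rightarrow> ('x \<Rightarrow> 'a) set \<Rightarrow> bool" where
  "satisfies_Sigma_on A X G F \<longleftrightarrow> (\<exists>t \<in> Clo A X. \<forall>p\<in>G. \<forall>v\<in>F. t v = perm_op X p t v)"

text \<open>
  HOL cannot quantify over types inside a formula, so the types of the elements and of the
  operation symbols are parameters; a statement that leaves them free speaks about all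
  algebras. The disjunction expresses \<open>|A\<^sup>X| \<ge> k\<close>, as \<open>card\<close> is \<open>0\<close> on infinite sets.
\<close>

definition local_global ::
  "'a itself \<Rightarrow> 'i itself \<Rightarrow> nat \<Rightarrow> 'x set \<Rightarrow> ('x \<Rightarrow> 'x) set \<Rightarrow> bool" where
  "local_global _ _ k X G \<longleftrightarrow>
     (\<forall>A :: ('a, 'i) ualgebra.
        is_ualgebra A \<longrightarrow>
        infinite (X \<rightarrow>\<^sub>E univ A) \<or> k \<le> card (X \<rightarrow>\<^sub>E univ A) \<longrightarrow>
        (\<forall>F \<subseteq> X \<rightarrow>\<^sub>E univ A. finite F \<and> card F = k \<longrightarrow> satisfies_Sigma_on A X G F) \<longrightarrow>
        (\<forall>F \<subseteq> X \<rightarrow>\<^sub>E univ A. finite F \<longrightarrow> satisfies_Sigma_on A X G F))"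


section \<open>Regular permutation groups and products with the natural action\<close>

text \<open>
  Permutation groups on \<open>X\<close> are the subgroups of \<^term>\<open>BijGroup X\<close>, given by their carriers. The
  regular permutation group of an abstract group \<open>H\<close> acts on \<open>carrier H\<close>.
\<close>

definition regular_perms :: "('g, 'm) monoid_scheme \<Rightarrow> ('g \<Rightarrow> 'g) set" where
  "regular_perms H = (\<lambda>h. \<lambda>x\<in>carrier H. h \<otimes>\<^bsub>H\<^esub> x) ` carrier H"

text \<open>The disjoint union of the \<open>X i\<close> is \<^term>\<open>Sigma I X\<close>.\<close>

definition product_perms ::
  "'j set \<Rightarrow> ('j \<Rightarrow> 'x set) \<Rightarrow> ('j \<Rightarrow> ('x \<Rightarrow> 'x) set) \<Rightarrow> ('j \<times> 'x \<Rightarrow> 'j \<times> 'x) set" where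
  "product_perms I X P = (\<lambda>p. \<lambda>(i, z)\<in>Sigma I X. (i, p i z)) ` Pi\<^sub>E I P"

lemma regular_perms_subgroup:
  assumes "group H"
  shows "subgroup (regular_perms H) (BijGroup (carrier H))"
proof -
  interpret group H by fact
  define L where "L = (\<lambda>h. \<lambda>x\<in>carrier H. h \<otimes>\<^bsub>H\<^esub> x)"
  have L_Bij: "L h \<in> Bij (carrier H)" if "h \<in> carrier H" for h
  proof -
    have "bij_betw (\<lambda>x. h \<otimes>\<^bsub>H\<^esub> x) (carrier H) (carrier H)"
      by (rule bij_betw_byWitness[where f' = "\<lambda>x. inv\<^bsub>H\<^esub> h \<otimes>\<^bsub>H\<^esub> x"])
        (use that in \<open>auto simp: m_assoc[symmetric]\<close>)
    then show ?thesis
      by (simp add: Bij_def L_def)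
  qed
  have L_mult: "L g \<otimes>\<^bsub>BijGroup (carrier H)\<^esub> L h = L (g \<otimes>\<^bsub>H\<^esub> h)"
    if "g \<in> carrier H" "h \<in> carrier H" for g h
    using that L_Bij[OF that(1)] L_Bij[OF that(2)]
    by (auto simp: BijGroup_def compose_def L_def m_assoc fun_eq_iff)
  have "group_hom H (BijGroup (carrier H)) L"
    using L_Bij L_mult group_BijGroup
    by (auto intro!: group_hom.intro group_hom_axioms.intro homI simp: BijGroup_def is_group)
  then show ?thesis
    using group_hom.img_is_subgroup by (fastforce simp: regular_perms_def L_def)
qed

lemma product_perms_subgroup:
  fixes P :: "'a \<Rightarrow> ('b \<Rightarrow> 'b) set"
  assumes "\<And>i. i \<in> I \<Longrightarrow> subgroup (P i) (BijGroup (X i))"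
  shows "subgroup (product_perms I X P) (BijGroup (Sigma I X))"
proof -
  let ?B = "BijGroup (Sigma I X)"
  define E :: "('a \<Rightarrow> 'b \<Rightarrow> 'b) \<Rightarrow> 'a \<times> 'b \<Rightarrow> 'a \<times> 'b" where "E = (\<lambda>p. \<lambda>(i, z)\<in>Sigma I X. (i, p i z))"
  interpret B: group ?B by (rule group_BijGroup)
  have P_Bij: "p i \<in> Bij (X i)" if "p \<in> Pi\<^sub>E I P" "i \<in> I" for p i
    using subgroup.subset[OF assms[OF that(2)]] that by (auto simp: BijGroup_def)
  have E_Bij: "E p \<in> Bij (Sigma I X)" if p: "p \<in> Pi\<^sub>E I P" for p
  proof -
    have bij: "bij_betw (p i) (X i) (X i)" if "i \<in> I" for i
      using P_Bij[OF p that] by (simp add: Bij_def)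
    have "bij_betw (\<lambda>(i, z). (i, p i z)) (Sigma I X) (Sigma I X)"
      by (rule bij_betw_byWitness[where f' = "\<lambda>(i, z). (i, inv_into (X i) (p i) z)"])
        (use bij in \<open>auto intro: bij_betw_inv_into_left bij_betw_inv_into_right
          bij_betwE[THEN bspec] bij_betw_inv_into[THEN bij_betwE, THEN bspec]\<close>)
    then show ?thesis
      by (simp add: Bij_def E_def)
  qed
  have E_mult: "E p \<otimes>\<^bsub>?B\<^esub> E q = E (\<lambda>i\<in>I. p i \<otimes>\<^bsub>BijGroup (X i)\<^esub> q i)"
    if p: "p \<in> Pi\<^sub>E I P" and q: "q \<in> Pi\<^sub>E I P" for p q
    using E_Bij[OF p] E_Bij[OF q] P_Bij[OF p] P_Bij[OF q] Bij_imp_funcset[OF P_Bij[OF q]]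
    by (auto simp: BijGroup_def compose_def E_def fun_eq_iff)
  have one: "(\<lambda>i\<in>I. \<one>\<^bsub>BijGroup (X i)\<^esub>) \<in> Pi\<^sub>E I P"
    using assms by (auto intro: subgroup.one_closed)
  have E_one: "E (\<lambda>i\<in>I. \<one>\<^bsub>BijGroup (X i)\<^esub>) = \<one>\<^bsub>?B\<^esub>"
    by (auto simp: BijGroup_def E_def fun_eq_iff)
  have "subgroup (E ` Pi\<^sub>E I P) ?B"
  proof (rule B.subgroupI)
    show "E ` Pi\<^sub>E I P \<subseteq> carrier ?B"
      using E_Bij by (auto simp: BijGroup_def)
    show "E ` Pi\<^sub>E I P \<noteq> {}"
      using one by blast
  next
    fix e assume "e \<in> E ` Pi\<^sub>E I P"
    then obtain p where p: "p \<in> Pi\<^sub>E I P" and e: "e = E p" by blast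
    define q where "q = (\<lambda>i\<in>I. inv\<^bsub>BijGroup (X i)\<^esub> p i)"
    have q: "q \<in> Pi\<^sub>E I P"
      using assms p by (auto simp: q_def PiE_iff intro: subgroup.m_inv_closed)
    have "E q \<otimes>\<^bsub>?B\<^esub> e = E (\<lambda>i\<in>I. q i \<otimes>\<^bsub>BijGroup (X i)\<^esub> p i)"
      unfolding e by (rule E_mult[OF q p])
    also have "(\<lambda>i\<in>I. q i \<otimes>\<^bsub>BijGroup (X i)\<^esub> p i) = (\<lambda>i\<in>I. \<one>\<^bsub>BijGroup (X i)\<^esub>)"
    proof (rule restrict_ext)
      fix i assume i: "i \<in> I"
      have "p i \<in> carrier (BijGroup (X i))"
        using P_Bij[OF p i] by (simp add: BijGroup_def)
      then show "q i \<otimes>\<^bsub>BijGroup (X i)\<^esub> p i = \<one>\<^bsub>BijGroup (X i)\<^esub>"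
        using group.l_inv[OF group_BijGroup] i by (simp add: q_def)
    qed
    finally have "E q \<otimes>\<^bsub>?B\<^esub> e = \<one>\<^bsub>?B\<^esub>" by (simp only: E_one)
    then have "inv\<^bsub>?B\<^esub> e = E q"
      using E_Bij p q e by (intro B.inv_equality) (auto simp: BijGroup_def)
    then show "inv\<^bsub>?B\<^esub> e \<in> E ` Pi\<^sub>E I P"
      using q by blast
  next
    fix e f assume "e \<in> E ` Pi\<^sub>E I P" "f \<in> E ` Pi\<^sub>E I P"
    then obtain p q where p: "p \<in> Pi\<^sub>E I P" "e = E p" and q: "q \<in> Pi\<^sub>E I P" "f = E q" by blast
    have "(\<lambda>i\<in>I. p i \<otimes>\<^bsub>BijGroup (X i)\<^esub> q i) \<in> Pi\<^sub>E I P"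
      using assms p q by (auto simp: PiE_iff intro: subgroup.m_closed)
    then show "e \<otimes>\<^bsub>?B\<^esub> f \<in> E ` Pi\<^sub>E I P"
      using E_mult[OF p(1) q(1)] p q by blast
  qed
  then show ?thesis
    by (simp add: product_perms_def E_def)
qed

end

theory Submission
  imports Defs
begin

text \<open>
  Write \<open>v\<cdot>h\<close> for the translate of a tuple \<open>v\<close> by a family \<open>h\<close> of group elements, and say that \<open>t\<close> is
  \<open>L\<close>-invariant at \<open>v\<close> if \<open>t (v\<cdot>h) = t v\<close> for all \<open>h\<close> that are trivial in the coordinates outside \<open>L\<close>.
  The identities hold on \<open>F\<close> when a single term is \<open>I\<close>-invariant at every tuple of \<open>F\<close>, where \<open>I\<close> is
  the set of all \<open>n\<close> indices.

  The engine is composition. Since every group is regular, the points of block \<open>i\<close> are the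
  elements of \<open>G\<^sub>i\<close>, so one term \<open>t\<close> yields a new block: replace block \<open>i\<close> of \<open>v\<close> by the values of \<open>t\<close>
  at the translates of \<open>v\<close> by the elements of \<open>G\<^sub>i\<close>. Let \<open>W v\<close> be the resulting tuple and
  \<open>s\<close> another term. Two effects drive the proof, for \<open>i \<in> L\<close>.
  If \<open>t\<close> is \<open>L\<close>-invariant at \<open>v\<close>, then the new block is constant, and \<open>s \<circ> W\<close> is \<open>L\<close>-invariant at \<open>v\<close> as
  soon as \<open>s\<close> is \<open>(L - {i})\<close>-invariant at \<open>W v\<close>. If \<open>t\<close> is only \<open>(L - {i})\<close>-invariant, but at all
  translates of \<open>v\<close> by \<open>G\<^sub>i\<close>, then \<open>W\<close> still commutes with the translations by \<open>h\<close> supported in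
  \<open>L\<close>, and \<open>s \<circ> W\<close> inherits \<open>L\<close>-invariance from \<open>s\<close>.

  This allows a trade between tuples of full invariance and a coordinate of invariance on an
  arbitrary finite set. Claim: if \<open>|V| + |M| \<le> n\<close>, then for every finite \<open>U\<close> some term is
  \<open>I\<close>-invariant on \<open>V\<close> and \<open>M\<close>-invariant on \<open>U\<close> (\<open>achievable_if_locally_achievable\<close>). For \<open>M = {}\<close> this is
  the hypothesis on \<open>n\<close>-element sets, and for \<open>M = I\<close>, \<open>V = {}\<close> it is the theorem. The induction
  step (\<open>extend_invariance\<close>) assumes the claim for the sets \<open>M - {i}\<close>, which permit one more
  fully invariant tuple. This spare tuple is spent on one \<open>u\<close> at a time: if \<open>t\<close> is \<open>K\<close>-invariant on
  all of \<open>U\<close>, closed under translation, and \<open>i \<in> M - K\<close>, choose \<open>s\<close> fully invariant at \<open>W u\<close> and on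
  \<open>W V\<close>, and \<open>(M - {i})\<close>-invariant on \<open>W U\<close>. By the second effect \<open>s \<circ> W\<close> is \<open>(K \<union> {i})\<close>-invariant at
  \<open>u\<close>, and by the first effect nothing that was achieved before for sets between \<open>K \<union> {i}\<close> and
  \<open>M\<close>, or on \<open>V\<close>, is lost. Once all \<open>u\<close> have been treated, \<open>K\<close> has grown by \<open>i\<close>.
\<close>

section \<open>Substitution of term operations\<close>

lemma Clo_subst:
  assumes "is_ualgebra A" and "t \<in> Clo A Y" and "\<And>y. y \<in> Y \<Longrightarrow> f y \<in> Clo A X"
  shows "(\<lambda>v \<in> X \<rightarrow>\<^sub>E univ A. t (\<lambda>y\<in>Y. f y v)) \<in> Clo A X"
proof -
  have f: "(\<lambda>y\<in>Y. f y v) \<in> Y \<rightarrow>\<^sub>E univ A" if "v \<in> X \<rightarrow>\<^sub>E univ A" for v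
    using Clo_funcset[OF assms(1) assms(3)] that by (auto simp: restrict_PiE_iff dest: PiE_mem)
  show ?thesis
    using assms(2)
  proof induction
    case (proj y)
    have "(\<lambda>v \<in> X \<rightarrow>\<^sub>E univ A. (\<lambda>w \<in> Y \<rightarrow>\<^sub>E univ A. w y) (\<lambda>y\<in>Y. f y v)) =
        restrict (f y) (X \<rightarrow>\<^sub>E univ A)"
    proof (rule restrict_ext)
      fix v assume v: "v \<in> X \<rightarrow>\<^sub>E univ A"
      show "(\<lambda>w \<in> Y \<rightarrow>\<^sub>E univ A. w y) (\<lambda>y\<in>Y. f y v) = f y v"
        using proj by (simp only: restrict_apply' f[OF v])
    qed
    also have "\<dots> = f y"
      using Clo_funcset[OF assms(1) assms(3)[OF proj]] by (rule PiE_restrict)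
    finally show ?case
      using assms(3)[OF proj] by (simp only:)
  next
    case (comp i t)
    have "(\<lambda>v \<in> X \<rightarrow>\<^sub>E univ A. oper A i (\<lambda>j\<in>{..<arity A i}.
             (\<lambda>v \<in> X \<rightarrow>\<^sub>E univ A. t j (\<lambda>y\<in>Y. f y v)) v)) \<in> Clo A X"
      using comp by (intro Clo.comp)
    also have "(\<lambda>v \<in> X \<rightarrow>\<^sub>E univ A. oper A i (\<lambda>j\<in>{..<arity A i}.
             (\<lambda>v \<in> X \<rightarrow>\<^sub>E univ A. t j (\<lambda>y\<in>Y. f y v)) v)) =
          (\<lambda>v \<in> X \<rightarrow>\<^sub>E univ A.
             (\<lambda>w \<in> Y \<rightarrow>\<^sub>E univ A. oper A i (\<lambda>j\<in>{..<arity A i}. t j w)) (\<lambda>y\<in>Y. f y v))"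
    proof (rule restrict_ext)
      fix v assume v: "v \<in> X \<rightarrow>\<^sub>E univ A"
      show "oper A i (\<lambda>j\<in>{..<arity A i}. (\<lambda>v \<in> X \<rightarrow>\<^sub>E univ A. t j (\<lambda>y\<in>Y. f y v)) v) =
          (\<lambda>w \<in> Y \<rightarrow>\<^sub>E univ A. oper A i (\<lambda>j\<in>{..<arity A i}. t j w)) (\<lambda>y\<in>Y. f y v)"
        by (simp only: restrict_apply' f[OF v] v)
    qed
    finally show ?case .
  qed
qed

section \<open>The product group acting on tuples\<close>

locale algebra_with_groups =
  fixes A :: "('a, 'i) ualgebra" and I :: "'j set" and G :: "'j \<Rightarrow> ('g, 'm) monoid_scheme"
  assumes alg: "is_ualgebra A"
    and finite_I: "finite I"
    and group: "i \<in> I \<Longrightarrow> group (G i)"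
    and finite_carrier: "i \<in> I \<Longrightarrow> finite (carrier (G i))"
begin

definition X :: "('j \<times> 'g) set" where
  "X = (SIGMA i:I. carrier (G i))"

definition tuples :: "('j \<times> 'g \<Rightarrow> 'a) set" where
  "tuples = X \<rightarrow>\<^sub>E univ A"

definition translate :: "('j \<times> 'g \<Rightarrow> 'a) \<Rightarrow> ('j \<Rightarrow> 'g) \<Rightarrow> 'j \<times> 'g \<Rightarrow> 'a" where
  "translate v h = (\<lambda>(j, z)\<in>X. v (j, h j \<otimes>\<^bsub>G j\<^esub> z))"

text \<open>
  Only the values on \<^term>\<open>I\<close> matter to \<^term>\<open>translate\<close>; leaving the others free avoids
  restrictions in products and updates of families.
\<close>

definition supported :: "'j set \<Rightarrow> ('j \<Rightarrow> 'g) set" where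
  "supported L = {h \<in> Pi I (\<lambda>i. carrier (G i)). \<forall>j\<in>I - L. h j = \<one>\<^bsub>G j\<^esub>}"

definition invariant_at :: "(('j \<times> 'g \<Rightarrow> 'a) \<Rightarrow> 'a) \<Rightarrow> 'j set \<Rightarrow> ('j \<times> 'g \<Rightarrow> 'a) \<Rightarrow> bool" where
  "invariant_at t L v \<longleftrightarrow> (\<forall>h\<in>supported L. t (translate v h) = t v)"

definition single :: "'j \<Rightarrow> 'g \<Rightarrow> 'j \<Rightarrow> 'g" where
  "single i z = (\<lambda>j. \<one>\<^bsub>G j\<^esub>)(i := z)"

definition replace_block ::
  "'j \<Rightarrow> (('j \<times> 'g \<Rightarrow> 'a) \<Rightarrow> 'a) \<Rightarrow> ('j \<times> 'g \<Rightarrow> 'a) \<Rightarrow> 'j \<times> 'g \<Rightarrow> 'a" where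
  "replace_block i t v = (\<lambda>(j, z)\<in>X. if j = i then t (translate v (single i z)) else v (j, z))"

lemma one_closed: "j \<in> I \<Longrightarrow> \<one>\<^bsub>G j\<^esub> \<in> carrier (G j)"
  by (simp add: group group.is_monoid monoid.one_closed)

lemma m_closed: 
  "j \<in> I \<Longrightarrow> x \<in> carrier (G j) \<Longrightarrow> y \<in> carrier (G j) \<Longrightarrow> x \<otimes>\<^bsub>G j\<^esub> y \<in> carrier (G j)"
  by (simp add: group group.is_monoid monoid.m_closed)

lemma l_one: "j \<in> I \<Longrightarrow> x \<in> carrier (G j) \<Longrightarrow> \<one>\<^bsub>G j\<^esub> \<otimes>\<^bsub>G j\<^esub> x = x"
  by (simp add: group group.is_monoid monoid.l_one)

lemma r_one: "j \<in> I \<Longrightarrow> x \<in> carrier (G j) \<Longrightarrow> x \<otimes>\<^bsub>G j\<^esub> \<one>\<^bsub>G j\<^esub> = x"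
  by (simp add: group group.is_monoid monoid.r_one)

lemma supported_mono: "K \<subseteq> L \<Longrightarrow> supported K \<subseteq> supported L"
  by (auto simp: supported_def)

lemma supported_closed: "h \<in> supported L \<Longrightarrow> j \<in> I \<Longrightarrow> h j \<in> carrier (G j)"
  by (auto simp: supported_def)

lemma single_supported: "i \<in> L \<Longrightarrow> z \<in> carrier (G i) \<Longrightarrow> single i z \<in> supported L"
  by (auto simp: supported_def single_def one_closed)

lemma supported_drop: "h \<in> supported L \<Longrightarrow> h(i := \<one>\<^bsub>G i\<^esub>) \<in> supported (L - {i})"
  by (auto simp: supported_def one_closed)

lemma supported_mult:
  "h \<in> supported L \<Longrightarrow> k \<in> supported L \<Longrightarrow> (\<lambda>j. h j \<otimes>\<^bsub>G j\<^esub> k j) \<in> supported L"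
  by (simp add: supported_def Pi_iff m_closed one_closed l_one)

lemma invariant_at_mono: "invariant_at t L v \<Longrightarrow> K \<subseteq> L \<Longrightarrow> invariant_at t K v"
  using supported_mono unfolding invariant_at_def by (meson subsetD)

lemma translate_in_tuples:
  "v \<in> tuples \<Longrightarrow> h \<in> supported L \<Longrightarrow> translate v h \<in> tuples"
  by (auto simp: tuples_def translate_def X_def PiE_iff m_closed dest: supported_closed)

lemma translate_translate:
  assumes "h \<in> supported L" "k \<in> supported L'"
  shows "translate (translate v h) k = translate v (\<lambda>j. h j \<otimes>\<^bsub>G j\<^esub> k j)"
  using supported_closed[OF assms(1)] supported_closed[OF assms(2)]
  by (auto simp: translate_def fun_eq_iff X_def m_closed group group.is_monoid monoid.m_assoc)

lemma translate_cong: "(\<And>j. j \<in> I \<Longrightarrow> h j = k j) \<Longrightarrow> translate v h = translate v k"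
  by (auto simp: translate_def fun_eq_iff X_def)

lemma translate_one: "v \<in> tuples \<Longrightarrow> translate v (\<lambda>j. \<one>\<^bsub>G j\<^esub>) = v"
  by (auto simp: translate_def fun_eq_iff X_def tuples_def l_one PiE_iff extensional_def)

lemma invariant_at_empty:
  assumes "u \<in> tuples"
  shows "invariant_at t {} u"
proof -
  have "translate u h = u" if "h \<in> supported {}" for h
    using that translate_cong[of h "\<lambda>j. \<one>\<^bsub>G j\<^esub>" u] translate_one[OF assms]
    by (auto simp: supported_def)
  then show ?thesis by (simp add: invariant_at_def)
qed

lemma replace_block_in_tuples:
  assumes "t \<in> Clo A X" "v \<in> tuples"
  shows "replace_block i t v \<in> tuples"
proof -
  have "t (translate v (single i z)) \<in> univ A" if "z \<in> carrier (G i)" for z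
    using Clo_funcset[OF alg assms(1)] translate_in_tuples[OF assms(2) single_supported[of i UNIV z]] that
    by (auto simp: tuples_def)
  then show ?thesis
    using assms(2) by (auto simp: tuples_def replace_block_def X_def PiE_iff)
qed

text \<open>
  Every entry of the new tuple is a term operation of the old one: a projection outside block \<open>i\<close>,
  and \<open>t\<close> with permuted variables inside it.
\<close>

lemma replace_block_Clo:
  assumes "i \<in> I" "s \<in> Clo A X" "t \<in> Clo A X"
  shows "(\<lambda>v\<in>tuples. s (replace_block i t v)) \<in> Clo A X"
proof -
  define f where "f = (\<lambda>(j, z). if j = i
     then (\<lambda>v\<in>tuples. t (\<lambda>x\<in>X. (\<lambda>(k, y). (\<lambda>v\<in>tuples. v (k, single i z k \<otimes>\<^bsub>G k\<^esub> y))) x v))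
     else (\<lambda>v\<in>tuples. v (j, z)))"
  have "f x \<in> Clo A X" if x: "x \<in> X" for x
  proof (cases "fst x = i")
    case True
    then obtain z where z: "x = (i, z)" "z \<in> carrier (G i)"
      using x by (cases x) (auto simp: X_def)
    have "(\<lambda>v\<in>tuples. t (\<lambda>x\<in>X. (\<lambda>(k, y). (\<lambda>v\<in>tuples. v (k, single i z k \<otimes>\<^bsub>G k\<^esub> y))) x v)) \<in> Clo A X"
      unfolding tuples_def
    proof (rule Clo_subst[OF alg assms(3)])
      fix y assume "y \<in> X"
      then obtain k y' where y: "y = (k, y')" "k \<in> I" "y' \<in> carrier (G k)"
        by (auto simp: X_def)
      have "(k, single i z k \<otimes>\<^bsub>G k\<^esub> y') \<in> X"
        using y supported_closed[OF single_supported[of i UNIV z] y(2)] z by (simp add: X_def m_closed)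
      from Clo.proj[OF this]
      show "(case y of (k, y) \<Rightarrow> \<lambda>v\<in>X \<rightarrow>\<^sub>E univ A. v (k, single i z k \<otimes>\<^bsub>G k\<^esub> y)) \<in> Clo A X"
        by (simp add: y)
    qed
    then show ?thesis by (simp add: f_def z)
  next
    case False
    then show ?thesis
      using Clo.proj[OF x] by (cases x) (simp add: f_def tuples_def)
  qed
  then have "(\<lambda>v\<in>tuples. s (\<lambda>x\<in>X. f x v)) \<in> Clo A X"
    unfolding tuples_def by (intro Clo_subst[OF alg assms(2)])
  also have "(\<lambda>v\<in>tuples. s (\<lambda>x\<in>X. f x v)) = (\<lambda>v\<in>tuples. s (replace_block i t v))"
  proof (rule restrict_ext)
    fix v assume v: "v \<in> tuples"
    have "(\<lambda>x\<in>X. f x v) = replace_block i t v"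
      using v by (auto simp: f_def replace_block_def translate_def fun_eq_iff
          intro!: arg_cong[of _ _ t])
    then show "s (\<lambda>x\<in>X. f x v) = s (replace_block i t v)" by simp
  qed
  finally show ?thesis .
qed

text \<open>
  In block \<open>i\<close>, the translation by \<open>h\<close> moves the point \<open>z\<close> to \<open>h\<^sub>i z\<close>, and the rest of \<open>h\<close>, which is
  supported in \<open>L - {i}\<close>, is absorbed by the invariance of \<open>t\<close> at the translate by \<open>h\<^sub>i z\<close>. That
  translate varies over all of \<open>G\<^sub>i\<close>, so invariance at \<open>v\<close> alone would not do.
\<close>

lemma replace_block_equivariant:
  assumes i: "i \<in> I" "i \<in> L" and h: "h \<in> supported L"
    and inv: "\<And>z. z \<in> carrier (G i) \<Longrightarrow> invariant_at t (L - {i}) (translate v (single i z))"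
  shows "replace_block i t (translate v h) = translate (replace_block i t v) h"
proof
  fix x
  show "replace_block i t (translate v h) x = translate (replace_block i t v) h x"
  proof (cases "x \<in> X \<and> fst x = i")
    case False
    then show ?thesis
      using supported_closed[OF h]
      by (cases x) (auto simp: replace_block_def translate_def X_def m_closed)
  next
    case True
    then obtain z where x: "x = (i, z)" "z \<in> carrier (G i)"
      by (cases x) (auto simp: X_def)
    have hz: "h i \<otimes>\<^bsub>G i\<^esub> z \<in> carrier (G i)"
      using supported_closed[OF h] x i by (simp add: m_closed)
    have "translate (translate v h) (single i z) = translate v (\<lambda>j. h j \<otimes>\<^bsub>G j\<^esub> single i z j)"
      by (rule translate_translate[OF h single_supported[OF i(2) x(2)]])
    also have "\<dots> = translate v (\<lambda>j. single i (h i \<otimes>\<^bsub>G i\<^esub> z) j \<otimes>\<^bsub>G j\<^esub> (h(i := \<one>\<^bsub>G i\<^esub>)) j)"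
      using supported_closed[OF h] x hz
      by (intro translate_cong) (auto simp: single_def l_one r_one)
    also have "\<dots> = translate (translate v (single i (h i \<otimes>\<^bsub>G i\<^esub> z))) (h(i := \<one>\<^bsub>G i\<^esub>))"
      by (rule translate_translate[OF single_supported[OF i(2) hz] supported_drop[OF h], symmetric])
    finally have "t (translate (translate v h) (single i z)) = t (translate v (single i (h i \<otimes>\<^bsub>G i\<^esub> z)))"
      using inv[OF hz] supported_drop[OF h] by (simp add: invariant_at_def)
    then show ?thesis
      using x i hz by (simp add: replace_block_def translate_def X_def)
  qed
qed

text \<open>
  The new block is constant and does not see \<open>h\<close>, so the coordinate \<open>i\<close> of \<open>h\<close> can be dropped.
\<close>

lemma replace_block_constant:
  assumes i: "i \<in> I" "i \<in> L" and h: "h \<in> supported L"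
    and inv: "invariant_at t L v"
  shows "replace_block i t (translate v h) = translate (replace_block i t v) (h(i := \<one>\<^bsub>G i\<^esub>))"
proof
  fix x
  show "replace_block i t (translate v h) x = translate (replace_block i t v) (h(i := \<one>\<^bsub>G i\<^esub>)) x"
  proof (cases "x \<in> X \<and> fst x = i")
    case False
    then show ?thesis
      using supported_closed[OF h]
      by (cases x) (auto simp: replace_block_def translate_def X_def m_closed)
  next
    case True
    then obtain z where x: "x = (i, z)" "z \<in> carrier (G i)"
      by (cases x) (auto simp: X_def)
    have z: "single i z \<in> supported L"
      using i x by (simp add: single_supported)
    have "t (translate (translate v h) (single i z)) = t v"
      using inv supported_mult[OF h z] by (simp add: translate_translate[OF h z] invariant_at_def)
    also have "\<dots> = t (translate v (single i z))"
      using inv z by (simp add: invariant_at_def)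
    finally show ?thesis
      using x i by (simp add: replace_block_def translate_def X_def l_one)
  qed
qed

lemma invariant_at_replace_block_if_translates:
  assumes v: "v \<in> tuples" and i: "i \<in> I" "i \<in> L"
    and inv: "\<And>z. z \<in> carrier (G i) \<Longrightarrow> invariant_at t (L - {i}) (translate v (single i z))"
    and s: "invariant_at s L (replace_block i t v)"
  shows "invariant_at (\<lambda>v\<in>tuples. s (replace_block i t v)) L v"
  using s v translate_in_tuples[OF v] replace_block_equivariant[OF i _ inv]
  by (simp add: invariant_at_def)

lemma invariant_at_replace_block_if_invariant:
  assumes v: "v \<in> tuples" and i: "i \<in> I" "i \<in> L"
    and inv: "invariant_at t L v"
    and s: "invariant_at s (L - {i}) (replace_block i t v)"
  shows "invariant_at (\<lambda>v\<in>tuples. s (replace_block i t v)) L v"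
  using s v translate_in_tuples[OF v] replace_block_constant[OF i _ inv] supported_drop
  by (simp add: invariant_at_def)

section \<open>Trading fully invariant tuples for coordinates of invariance\<close>

text \<open>Full invariance on \<open>V\<close> is the scarce resource, and \<open>M\<close>-invariance on \<open>U\<close> is what it buys.\<close>

definition achievable :: "('j \<times> 'g \<Rightarrow> 'a) set \<Rightarrow> 'j set \<Rightarrow> ('j \<times> 'g \<Rightarrow> 'a) set \<Rightarrow> bool" where
  "achievable V M U \<longleftrightarrow> (\<exists>t\<in>Clo A X. (\<forall>v\<in>V. invariant_at t I v) \<and> (\<forall>u\<in>U. invariant_at t M u))"

text \<open>
  The last conjunct is what makes the induction on \<open>K\<close> work. The tuples \<open>u\<close> are treated one at a
  time, and before each of them \<open>K\<close>-invariance must be re-established on all translates of \<open>u\<close>,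
  without losing the \<open>(K \<union> {i})\<close>-invariance at the tuples already treated. Protecting every set \<open>L\<close>
  between \<open>K\<close> and \<open>M\<close> covers all levels of the recursion at once.
\<close>

lemma extend_invariance:
  assumes IH: "\<And>i V U. i \<in> M \<Longrightarrow> finite V \<Longrightarrow> finite U \<Longrightarrow> V \<subseteq> tuples \<Longrightarrow> U \<subseteq> tuples \<Longrightarrow>
      card V \<le> Suc k \<Longrightarrow> achievable V (M - {i}) U"
    and M: "M \<subseteq> I"
    and V: "finite V" "V \<subseteq> tuples" "card V \<le> k"
    and Z: "finite Z" "Z \<subseteq> tuples"
    and Z_closed: "\<And>v i z. v \<in> Z \<Longrightarrow> i \<in> I \<Longrightarrow> z \<in> carrier (G i) \<Longrightarrow> translate v (single i z) \<in> Z"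
    and K: "K \<subseteq> M"
    and t: "t \<in> Clo A X" "\<And>v. v \<in> V \<Longrightarrow> invariant_at t I v"
  shows "\<exists>s\<in>Clo A X. (\<forall>v\<in>V. invariant_at s I v) \<and> (\<forall>u\<in>Z. invariant_at s K u) \<and>
    (\<forall>w\<in>Z. \<forall>L. K \<subseteq> L \<longrightarrow> L \<subseteq> M \<longrightarrow> invariant_at t L w \<longrightarrow> invariant_at s L w)"
proof -
  have "finite K"
    using K M finite_I by (meson finite_subset)
  then show ?thesis
    using K t
  proof (induction K arbitrary: t rule: finite_induct)
    case empty
    show ?case
      using empty Z(2) invariant_at_empty by (intro bexI[of _ t]) auto
  next
    case (insert i K)
    note i = \<open>i \<notin> K\<close> and outer_IH = insert.IH and prems = insert.prems
    have iM: "i \<in> M" "i \<in> I"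
      using insert.prems M by auto
    have "\<exists>s\<in>Clo A X. (\<forall>v\<in>V. invariant_at s I v) \<and> (\<forall>u\<in>U. invariant_at s (insert i K) u) \<and>
      (\<forall>w\<in>Z. \<forall>L. insert i K \<subseteq> L \<longrightarrow> L \<subseteq> M \<longrightarrow> invariant_at t L w \<longrightarrow> invariant_at s L w)"
      if "finite U" "U \<subseteq> Z" for U
      using that
    proof (induction U rule: finite_induct)
      case empty
      then show ?case
        using insert.prems by (intro bexI[of _ t]) auto
    next
      case (insert u U)
      then obtain r where r: "r \<in> Clo A X" "\<And>v. v \<in> V \<Longrightarrow> invariant_at r I v"
        "\<And>v. v \<in> U \<Longrightarrow> invariant_at r (insert i K) v"
        "\<And>w L. w \<in> Z \<Longrightarrow> insert i K \<subseteq> L \<Longrightarrow> L \<subseteq> M \<Longrightarrow> invariant_at t L w \<Longrightarrow> invariant_at r L w"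
        by auto
      \<comment> \<open>The equivariance at \<open>u\<close> needs \<open>K\<close>-invariance at all translates of \<open>u\<close>, which \<open>r\<close> need not have.\<close>
      obtain q where q: "q \<in> Clo A X" "\<And>v. v \<in> V \<Longrightarrow> invariant_at q I v"
        "\<And>v. v \<in> Z \<Longrightarrow> invariant_at q K v"
        "\<And>w L. w \<in> Z \<Longrightarrow> K \<subseteq> L \<Longrightarrow> L \<subseteq> M \<Longrightarrow> invariant_at r L w \<Longrightarrow> invariant_at q L w"
        using outer_IH[of r] prems r(1,2) by auto
      let ?W = "replace_block i q"
      have W: "?W v \<in> tuples" if "v \<in> tuples" for v
        using replace_block_in_tuples[OF q(1) that] .
      \<comment> \<open>Dropping \<open>i\<close> from \<open>M\<close> leaves room for one tuple beyond \<open>V\<close>, which is used for \<open>u\<close>.\<close>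
      have "achievable (?W ` insert u V) (M - {i}) (?W ` Z)"
      proof (rule IH)
        have "card (?W ` insert u V) \<le> card (insert u V)"
          using V(1) by (intro card_image_le) auto
        also have "\<dots> \<le> Suc k"
          using V by (auto simp: card_insert_if)
        finally show "card (?W ` insert u V) \<le> Suc k" .
      qed (use iM V Z W insert.prems in auto)
      then obtain s where s: "s \<in> Clo A X" "invariant_at s I (?W u)"
        "\<And>v. v \<in> V \<Longrightarrow> invariant_at s I (?W v)" "\<And>v. v \<in> Z \<Longrightarrow> invariant_at s (M - {i}) (?W v)"
        by (auto simp: achievable_def)
      let ?s = "\<lambda>v\<in>tuples. s (?W v)"
      have keep: "invariant_at ?s L w"
        if "w \<in> Z" "insert i K \<subseteq> L" "L \<subseteq> M" "invariant_at r L w" for w L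
      proof (rule invariant_at_replace_block_if_invariant)
        show "invariant_at s (L - {i}) (?W w)"
          using that s(4) invariant_at_mono[of s "M - {i}" "?W w" "L - {i}"] by auto
      qed (use that q(4) iM Z in auto)
      show ?case
      proof (intro bexI conjI ballI allI impI)
        show "?s \<in> Clo A X"
          by (rule replace_block_Clo[OF iM(2) s(1) q(1)])
        show "invariant_at ?s I v" if "v \<in> V" for v
          using that V iM q(2) s(3)[OF that]
          by (intro invariant_at_replace_block_if_invariant) (auto intro: invariant_at_mono)
        show "invariant_at ?s L w" if "w \<in> Z" "insert i K \<subseteq> L" "L \<subseteq> M" "invariant_at t L w" for w L
          using that r(4) keep by blast
        show "invariant_at ?s (insert i K) w" if "w \<in> insert u U" for w
        proof (cases "w = u")
          case True
          show ?thesis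
          proof (rule invariant_at_replace_block_if_translates)
            show "invariant_at s (insert i K) (?W w)"
              using s(2) True \<open>insert i K \<subseteq> M\<close> M by (auto intro: invariant_at_mono)
          qed (use True i iM insert.prems Z Z_closed q(3) in auto)
        next
          case False
          then show ?thesis
            using that insert.prems \<open>insert i K \<subseteq> M\<close> r(3) by (intro keep) auto
        qed
      qed
    qed
    from this[OF Z(1)] show ?case by blast
  qed
qed

definition orbits :: "('j \<times> 'g \<Rightarrow> 'a) set \<Rightarrow> ('j \<times> 'g \<Rightarrow> 'a) set" where
  "orbits U = (\<lambda>(v, h). translate v h) ` (U \<times> (\<Pi>\<^sub>E i\<in>I. carrier (G i)))"

lemma orbitsI:
  assumes "v \<in> U" "h \<in> supported L"
  shows "translate v h \<in> orbits U"
proof -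
  have "translate v h = translate v (restrict h I)"
    by (rule translate_cong) simp
  moreover have "restrict h I \<in> (\<Pi>\<^sub>E i\<in>I. carrier (G i))"
    using supported_closed[OF assms(2)] by auto
  ultimately show ?thesis
    using assms(1) by (force simp: orbits_def)
qed

lemma orbitsE:
  assumes "w \<in> orbits U"
  obtains v h where "v \<in> U" "h \<in> supported I" "w = translate v h"
  using assms by (auto simp: orbits_def supported_def PiE_iff)

lemma orbits_translate:
  assumes "w \<in> orbits U" "k \<in> supported L"
  shows "translate w k \<in> orbits U"
  using assms(1)
proof (rule orbitsE)
  fix v h assume v: "v \<in> U" and h: "h \<in> supported I" and w: "w = translate v h"
  have "k \<in> supported I"
    using assms(2) by (auto simp: supported_def)
  with h show "translate w k \<in> orbits U"
    using v by (simp add: w translate_translate orbitsI[OF _ supported_mult])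
qed

lemma subset_orbits: "U \<subseteq> tuples \<Longrightarrow> U \<subseteq> orbits U"
  using orbitsI[of _ U "\<lambda>j. \<one>\<^bsub>G j\<^esub>" "{}"] translate_one
  by (fastforce simp: supported_def one_closed)

lemma orbits_in_tuples: "U \<subseteq> tuples \<Longrightarrow> orbits U \<subseteq> tuples"
  by (auto elim!: orbitsE intro: translate_in_tuples)

lemma finite_orbits: "finite U \<Longrightarrow> finite (orbits U)"
  by (simp add: orbits_def finite_I finite_carrier finite_PiE)

text \<open>
  The induction on \<open>|M|\<close> starts from the hypothesis and enlarges \<open>U\<close> to a finite union of orbits,
  because extending the invariance at a tuple involves its translates.
\<close>

lemma achievable_if_locally_achievable:
  assumes local: "\<And>V. finite V \<Longrightarrow> V \<subseteq> tuples \<Longrightarrow> card V \<le> k \<Longrightarrow> achievable V {} {}"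
    and "M \<subseteq> I" "finite V" "V \<subseteq> tuples" "finite U" "U \<subseteq> tuples" "card V + card M \<le> k"
  shows "achievable V M U"
  using assms(2-)
proof (induction "card M" arbitrary: M V U)
  case 0
  then have "M = {}"
    using finite_I by (metis card_0_eq finite_subset)
  moreover obtain t where "t \<in> Clo A X" "\<forall>v\<in>V. invariant_at t I v"
    using local[of V] 0 by (auto simp: achievable_def)
  ultimately show ?case
    using 0 invariant_at_empty unfolding achievable_def by (intro bexI[of _ t]) auto
next
  case (Suc m)
  have "finite M"
    using Suc.prems finite_I by (meson finite_subset)
  obtain t where t: "t \<in> Clo A X" "\<And>v. v \<in> V \<Longrightarrow> invariant_at t I v"
    using local[of V] Suc.prems by (auto simp: achievable_def)
  have "\<exists>s\<in>Clo A X. (\<forall>v\<in>V. invariant_at s I v) \<and> (\<forall>u\<in>orbits U. invariant_at s M u) \<and>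
    (\<forall>w\<in>orbits U. \<forall>L. M \<subseteq> L \<longrightarrow> L \<subseteq> M \<longrightarrow> invariant_at t L w \<longrightarrow> invariant_at s L w)"
  proof (rule extend_invariance[where k = "card V"])
    fix i V' U' assume *: "i \<in> M" "finite V'" "finite U'" "V' \<subseteq> tuples" "U' \<subseteq> tuples"
      "card V' \<le> Suc (card V)"
    have "m = card (M - {i})"
      using Suc.hyps(2) * \<open>finite M\<close> by simp
    then show "achievable V' (M - {i}) U'"
      using * Suc.prems Suc.hyps(2) by (intro Suc.hyps(1)) auto
  next
    fix v i z assume "v \<in> orbits U" "i \<in> I" "z \<in> carrier (G i)"
    then show "translate v (single i z) \<in> orbits U"
      using orbits_translate single_supported[of i "{i}" z] by blast
  qed (use Suc.prems t finite_orbits orbits_in_tuples in auto)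
  then obtain s where "s \<in> Clo A X" "\<forall>v\<in>V. invariant_at s I v" "\<forall>u\<in>orbits U. invariant_at s M u"
    by blast
  then show ?case
    using subset_orbits[of U] Suc.prems unfolding achievable_def by (intro bexI[of _ s]) auto
qed

section \<open>From invariance to the identities\<close>

lemma product_perms_eq:
  "product_perms I (\<lambda>i. carrier (G i)) (\<lambda>i. regular_perms (G i)) =
   (\<lambda>h. \<lambda>(i, z)\<in>X. (i, h i \<otimes>\<^bsub>G i\<^esub> z)) ` supported I"
proof (intro equalityI subsetI)
  fix p assume "p \<in> product_perms I (\<lambda>i. carrier (G i)) (\<lambda>i. regular_perms (G i))"
  then obtain q where q: "q \<in> (\<Pi>\<^sub>E i\<in>I. regular_perms (G i))"
    and p: "p = (\<lambda>(i, z)\<in>X. (i, q i z))"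
    by (auto simp: product_perms_def X_def)
  have "\<forall>i\<in>I. \<exists>g\<in>carrier (G i). q i = (\<lambda>x\<in>carrier (G i). g \<otimes>\<^bsub>G i\<^esub> x)"
    using q by (auto simp: regular_perms_def PiE_iff)
  then obtain h where h: "\<And>i. i \<in> I \<Longrightarrow> h i \<in> carrier (G i)"
    "\<And>i. i \<in> I \<Longrightarrow> q i = (\<lambda>x\<in>carrier (G i). h i \<otimes>\<^bsub>G i\<^esub> x)"
    by metis
  have "p = (\<lambda>(i, z)\<in>X. (i, h i \<otimes>\<^bsub>G i\<^esub> z))"
    using h(2) by (auto simp: p X_def fun_eq_iff)
  moreover have "h \<in> supported I"
    using h(1) by (auto simp: supported_def)
  ultimately show "p \<in> (\<lambda>h. \<lambda>(i, z)\<in>X. (i, h i \<otimes>\<^bsub>G i\<^esub> z)) ` supported I"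
    by blast
next
  fix p assume "p \<in> (\<lambda>h. \<lambda>(i, z)\<in>X. (i, h i \<otimes>\<^bsub>G i\<^esub> z)) ` supported I"
  then obtain h where h: "h \<in> supported I" and p: "p = (\<lambda>(i, z)\<in>X. (i, h i \<otimes>\<^bsub>G i\<^esub> z))"
    by blast
  let ?q = "\<lambda>i\<in>I. \<lambda>x\<in>carrier (G i). h i \<otimes>\<^bsub>G i\<^esub> x"
  have "?q \<in> (\<Pi>\<^sub>E i\<in>I. regular_perms (G i))"
    using supported_closed[OF h] by (auto simp: regular_perms_def)
  moreover have "p = (\<lambda>(i, z)\<in>Sigma I (\<lambda>i. carrier (G i)). (i, ?q i z))"
    by (auto simp: p X_def fun_eq_iff)
  ultimately show "p \<in> product_perms I (\<lambda>i. carrier (G i)) (\<lambda>i. regular_perms (G i))"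
    unfolding product_perms_def by blast
qed

lemma satisfies_Sigma_on_iff:
  "satisfies_Sigma_on A X (product_perms I (\<lambda>i. carrier (G i)) (\<lambda>i. regular_perms (G i))) F \<longleftrightarrow>
   (\<exists>t\<in>Clo A X. \<forall>v\<in>F. invariant_at t I v)"
proof -
  have perm: "perm_op X (\<lambda>(i, z)\<in>X. (i, h i \<otimes>\<^bsub>G i\<^esub> z)) t v = t (translate v h)"
    for h t and v :: "'j \<times> 'g \<Rightarrow> 'a"
    unfolding perm_op_def translate_def
    by (rule arg_cong[of _ _ t]) (auto simp: fun_eq_iff)
  show ?thesis
    unfolding satisfies_Sigma_on_def product_perms_eq invariant_at_def ball_simps perm
    by (rule bex_cong[OF refl]) (auto simp: eq_commute)
qed

text \<open>
  The hypothesis concerns sets of exactly \<open>|I|\<close> tuples; there are enough tuples to enlarge smaller sets.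
\<close>

lemma local_global_product:
  assumes large: "infinite tuples \<or> card I \<le> card tuples"
    and local: "\<And>V. V \<subseteq> tuples \<Longrightarrow> finite V \<Longrightarrow> card V = card I \<Longrightarrow>
      satisfies_Sigma_on A X (product_perms I (\<lambda>i. carrier (G i)) (\<lambda>i. regular_perms (G i))) V"
    and F: "F \<subseteq> tuples" "finite F"
  shows "satisfies_Sigma_on A X (product_perms I (\<lambda>i. carrier (G i)) (\<lambda>i. regular_perms (G i))) F"
proof -
  have "achievable V {} {}" if V: "finite V" "V \<subseteq> tuples" "card V \<le> card I" for V
  proof -
    obtain V' where V': "V \<subseteq> V'" "V' \<subseteq> tuples" "finite V'" "card V' = card I"
    proof (cases "finite tuples")
      case True
      then obtain V' where "V \<subseteq> V'" "V' \<subseteq> tuples" "card V' = card I"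
        using exists_subset_between[of V "card I" tuples] V large by auto
      then show ?thesis
        using that finite_subset[OF _ True] by simp
    next
      case False
      then obtain B where B: "finite B" "card B = card I - card V" "B \<subseteq> tuples - V"
        using infinite_arbitrarily_large[of "tuples - V" "card I - card V"] V(1) by auto
      then have "card (V \<union> B) = card I"
        using V by (subst card_Un_disjoint) auto
      then show ?thesis
        using that[of "V \<union> B"] V B by blast
    qed
    obtain t where "t \<in> Clo A X" "\<forall>v\<in>V'. invariant_at t I v"
      using local[OF V'(2,3,4)] unfolding satisfies_Sigma_on_iff by (elim bexE)
    then show ?thesis
      using V'(1) unfolding achievable_def by blast
  qed
  then have "achievable {} I F"
    by (rule achievable_if_locally_achievable[where k = "card I"]) (use F in simp_all)
  then show ?thesis
    unfolding satisfies_Sigma_on_iff achievable_def by blast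
qed

end

theorem theorem15:
  fixes G :: "nat \<Rightarrow> ('g, 'm) monoid_scheme" and n :: nat
  assumes "n \<ge> 1"
    and "\<And>i. i \<in> {1..n} \<Longrightarrow> group (G i)"
    and "\<And>i. i \<in> {1..n} \<Longrightarrow> finite (carrier (G i))"
  shows "local_global TYPE('a) TYPE('i) n
           (SIGMA i:{1..n}. carrier (G i))
           (product_perms {1..n} (\<lambda>i. carrier (G i)) (\<lambda>i. regular_perms (G i)))"
  unfolding local_global_def
proof (intro allI impI)
  fix A :: "('a, 'i) ualgebra" and F
  let ?X = "SIGMA i:{1..n}. carrier (G i)"
  let ?P = "product_perms {1..n} (\<lambda>i. carrier (G i)) (\<lambda>i. regular_perms (G i))"
  assume alg: "is_ualgebra A"
    and large: "infinite (?X \<rightarrow>\<^sub>E univ A) \<or> n \<le> card (?X \<rightarrow>\<^sub>E univ A)"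
    and local: "\<forall>F \<subseteq> ?X \<rightarrow>\<^sub>E univ A. finite F \<and> card F = n \<longrightarrow> satisfies_Sigma_on A ?X ?P F"
    and F: "F \<subseteq> ?X \<rightarrow>\<^sub>E univ A" "finite F"
  have product: "algebra_with_groups A {1..n} G"
    using alg assms by (intro algebra_with_groups.intro)
      (assumption | rule finite_atLeastAtMost)+
  have card: "card {1..n} = n"
    by simp
  show "satisfies_Sigma_on A ?X ?P F"
  proof (rule algebra_with_groups.local_global_product[OF product,
        unfolded algebra_with_groups.tuples_def[OF product] algebra_with_groups.X_def[OF product] card])
    show "satisfies_Sigma_on A ?X ?P V" if "V \<subseteq> ?X \<rightarrow>\<^sub>E univ A" "finite V" "card V = n" for V
      using local that by (elim allE[of _ V] impE conjE) (rule conjI | assumption)+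
  qed (fact large F)+
qed

end
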